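(* There exists a ring that is both left linearly McCoy and right linearly McCoy but is not right Dischinger.
   Context: For a ring $S$, let $S[t]$ be the polynomial ring in a central indeterminate $t$. $S$ is right linearly McCoy if for any two nonzero polynomials $f,g\in S[t]$ of degree at most $1$ with $fg=0$, there exists a nonzero $s\in S$ with $fs=0$. $S$ is left linearly McCoy if for any two nonzero polynomials $f,g\in S[t]$ of degree at most $1$ with $fg=0$, there exists a nonzero $s\in S$ with $sg=0$. An element $s\in S$ is right strongly regular if $s=s^2y$ for some $y\in S$, left strongly regular if $s=ys^2$ for some $y\in S$, and strongly regular if both. $S$ is right Dischinger if every right strongly regular element of $S$ is strongly regular. *)

theory Defs
  imports "HOL-Algebra.UnivPoly"
begin

text \<open>
  Rings are associative and unital, not necessarily commutative. The theory of univariate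
  polynomials defines \<open>UP S\<close> (with central indeterminate) for such rings. Multiplying
  a polynomial by a ring element \<open>s\<close> means multiplying, in \<open>UP S\<close>, by the constant
  polynomial \<open>monom (UP S) s 0\<close>.
\<close>

definition right_linearly_McCoy :: "('a, 'm) ring_scheme \<Rightarrow> bool" where
  "right_linearly_McCoy S \<longleftrightarrow>
    (\<forall>f \<in> carrier (UP S). \<forall>g \<in> carrier (UP S).
      f \<noteq> \<zero>\<^bsub>UP S\<^esub> \<and> g \<noteq> \<zero>\<^bsub>UP S\<^esub> \<and> deg S f \<le> 1 \<and> deg S g \<le> 1 \<and>
      f \<otimes>\<^bsub>UP S\<^esub> g = \<zero>\<^bsub>UP S\<^esub> \<longrightarrow>
      (\<exists>s \<in> carrier S. s \<noteq> \<zero>\<^bsub>S\<^esub> \<and> f \<otimes>\<^bsub>UP S\<^esub> monom (UP S) s 0 = \<zero>\<^bsub>UP S\<^esub>))"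

definition left_linearly_McCoy :: "('a, 'm) ring_scheme \<Rightarrow> bool" where
  "left_linearly_McCoy S \<longleftrightarrow>
    (\<forall>f \<in> carrier (UP S). \<forall>g \<in> carrier (UP S).
      f \<noteq> \<zero>\<^bsub>UP S\<^esub> \<and> g \<noteq> \<zero>\<^bsub>UP S\<^esub> \<and> deg S f \<le> 1 \<and> deg S g \<le> 1 \<and>
      f \<otimes>\<^bsub>UP S\<^esub> g = \<zero>\<^bsub>UP S\<^esub> \<longrightarrow>
      (\<exists>s \<in> carrier S. s \<noteq> \<zero>\<^bsub>S\<^esub> \<and> monom (UP S) s 0 \<otimes>\<^bsub>UP S\<^esub> g = \<zero>\<^bsub>UP S\<^esub>))"

definition right_strongly_regular :: "('a, 'm) ring_scheme \<Rightarrow> 'a \<Rightarrow> bool" where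
  "right_strongly_regular S s \<longleftrightarrow>
    (\<exists>y \<in> carrier S. s = s [^]\<^bsub>S\<^esub> (2::nat) \<otimes>\<^bsub>S\<^esub> y)"

definition left_strongly_regular :: "('a, 'm) ring_scheme \<Rightarrow> 'a \<Rightarrow> bool" where
  "left_strongly_regular S s \<longleftrightarrow>
    (\<exists>y \<in> carrier S. s = y \<otimes>\<^bsub>S\<^esub> s [^]\<^bsub>S\<^esub> (2::nat))"

definition strongly_regular :: "('a, 'm) ring_scheme \<Rightarrow> 'a \<Rightarrow> bool" where
  "strongly_regular S s \<longleftrightarrow> right_strongly_regular S s \<and> left_strongly_regular S s"

definition right_Dischinger :: "('a, 'm) ring_scheme \<Rightarrow> bool" where
  "right_Dischinger S \<longleftrightarrow>
    (\<forall>s \<in> carrier S. right_strongly_regular S s \<longrightarrow> strongly_regular S s)"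

end

theory Submission
  imports Defs "HOL-Library.Poly_Mapping" "HOL-Library.List_Lexorder" "HOL-Library.FSet"
begin

text \<open>
  The example is the ring \<open>R\<close> generated by \<open>s\<close> and \<open>y\<close> over the
  integers with the single relation \<open>ssy = s\<close>, that is, the monoid ring of
  \<open>M = \<langle>s, y | ssy = s\<rangle>\<close>. By its relation \<open>s\<close> is right strongly regular. It is not
  left strongly regular: rewriting \<open>ssy\<close> to \<open>s\<close> never shortens a run of
  \<open>s\<close> at the end of a word, so all elements of \<open>R s\<^sup>2\<close> are supported on words whose
  normal form ends in \<open>ss\<close>.

  Put \<open>p = 1 - sy\<close>, so that \<open>sp = 0\<close>. The McCoy conditions follow from the fact
  (\<open>zero_product\<close>) that all zero divisors of \<open>R\<close> come from this equation: if
  \<open>xc = 0\<close> with \<open>x\<close> and \<open>c\<close> nonzero, then \<open>xp = 0\<close>, and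
  \<open>s\<^sup>n c = 0\<close> for some \<open>n\<close>. These annihilators hardly depend on \<open>x\<close> and
  \<open>c\<close>: if \<open>(a + bt)(c + dt) = 0\<close>, then each nonzero coefficient of either factor
  takes part in a vanishing product of two nonzero coefficients: in \<open>ac\<close> or
  \<open>bd\<close>, or, when one of the four is zero, in the only remaining term of
  \<open>ad + bc\<close>. Hence \<open>p\<close> kills the left factor from the right, and a high power of \<open>s\<close>
  kills the right factor from the left.

  To prove \<open>zero_product\<close>, write \<open>x = x' s\<^sup>n\<close> with \<open>n\<close> as large as possible,
  so that some word in the support of \<open>x'\<close> does not end in \<open>s\<close>. A leading term argument
  shows that such an \<open>x'\<close> is left regular (\<open>mult_nonzero_if_key_without_s\<close>). So
  \<open>x' (s\<^sup>n c) = 0\<close> forces \<open>s\<^sup>n c = 0\<close>; then \<open>n > 0\<close> because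
  \<open>c\<close> is nonzero, and \<open>xp = x' s\<^sup>n p = 0\<close>.

  The leading term argument is delicate because lengths can drop in a product. The words without
  \<open>ssy\<close> are uniquely of the form \<open>z s\<^sup>j\<close> with \<open>z\<close> a word in \<open>y\<close>
  and \<open>q = sy\<close>. Left multiplication by \<open>s\<close> erases all leading letters \<open>q\<close>
  of \<open>z\<close> and then turns the first \<open>y\<close> into \<open>q\<close>, or raises \<open>j\<close> by one if
  there is no \<open>y\<close>. Thus it leaves a suffix of \<open>z\<close> alone and lowers the letter in
  front of it, for the order \<open>q < y\<close>. Comparing words from their right ends, with
  \<open>q < y\<close> and every proper suffix smaller than the whole word, therefore singles out a term
  of \<open>c\<close> which the terms of \<open>x'\<close> ending in \<open>s\<close> cannot imitate
  (\<open>leading_factorization_unique\<close>).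
\<close>

section \<open>Linear zero divisors in coordinates\<close>

lemma coeffs_linear_product:
  assumes "ring S" and f: "f \<in> carrier (UP S)" and g: "g \<in> carrier (UP S)"
    and df: "deg S f \<le> 1" and dg: "deg S g \<le> 1"
    and fg: "f \<otimes>\<^bsub>UP S\<^esub> g = \<zero>\<^bsub>UP S\<^esub>"
  defines "a \<equiv> coeff (UP S) f 0" and "b \<equiv> coeff (UP S) f 1"
    and "c \<equiv> coeff (UP S) g 0" and "d \<equiv> coeff (UP S) g 1"
  shows "a \<otimes>\<^bsub>S\<^esub> c = \<zero>\<^bsub>S\<^esub>" "a \<otimes>\<^bsub>S\<^esub> d \<oplus>\<^bsub>S\<^esub> b \<otimes>\<^bsub>S\<^esub> c = \<zero>\<^bsub>S\<^esub>" "b \<otimes>\<^bsub>S\<^esub> d = \<zero>\<^bsub>S\<^esub>"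
proof -
  interpret S: ring S by fact
  interpret UP_ring S "UP S" by unfold_locales auto
  note [simp] = f g
  have f2: "coeff (UP S) f 2 = \<zero>\<^bsub>S\<^esub>" and g2: "coeff (UP S) g 2 = \<zero>\<^bsub>S\<^esub>"
    using deg_aboveD[of f 2] deg_aboveD[of g 2] df dg by auto
  have cl: "coeff (UP S) f n \<in> carrier S" "coeff (UP S) g n \<in> carrier S" for n
    by auto
  have prod: "(\<Oplus>\<^bsub>S\<^esub>i\<in>{..n}. coeff (UP S) f i \<otimes>\<^bsub>S\<^esub> coeff (UP S) g (n - i)) = \<zero>\<^bsub>S\<^esub>" for n
    using coeff_mult[OF f g, of n] fg by simp
  show "a \<otimes>\<^bsub>S\<^esub> c = \<zero>\<^bsub>S\<^esub>"
    using prod[of 0] cl by (simp add: a_def c_def)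
  have "b \<otimes>\<^bsub>S\<^esub> c \<oplus>\<^bsub>S\<^esub> a \<otimes>\<^bsub>S\<^esub> d = \<zero>\<^bsub>S\<^esub>"
    using prod[of 1] cl by (simp add: a_def b_def c_def d_def)
  moreover have "a \<otimes>\<^bsub>S\<^esub> d \<oplus>\<^bsub>S\<^esub> b \<otimes>\<^bsub>S\<^esub> c = b \<otimes>\<^bsub>S\<^esub> c \<oplus>\<^bsub>S\<^esub> a \<otimes>\<^bsub>S\<^esub> d"
    unfolding a_def b_def c_def d_def by (intro S.a_comm S.m_closed cl)
  ultimately show "a \<otimes>\<^bsub>S\<^esub> d \<oplus>\<^bsub>S\<^esub> b \<otimes>\<^bsub>S\<^esub> c = \<zero>\<^bsub>S\<^esub>"
    by simp
  show "b \<otimes>\<^bsub>S\<^esub> d = \<zero>\<^bsub>S\<^esub>"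
    using prod[of 2] cl f2 g2 by (simp add: b_def d_def numeral_2_eq_2)
qed

lemma linear_nonzero_coeff:
  assumes "ring S" "f \<in> carrier (UP S)" "deg S f \<le> 1" "f \<noteq> \<zero>\<^bsub>UP S\<^esub>"
  shows "coeff (UP S) f 0 \<noteq> \<zero>\<^bsub>S\<^esub> \<or> coeff (UP S) f 1 \<noteq> \<zero>\<^bsub>S\<^esub>"
proof -
  interpret S: ring S by fact
  interpret UP_ring S "UP S" by unfold_locales auto
  show ?thesis
    using lcoeff_nonzero[of f] assms le_Suc_eq[of "deg S f" 0] by auto
qed

lemma linear_mult_const_zero:
  assumes "ring S" and f: "f \<in> carrier (UP S)" and df: "deg S f \<le> 1" and s: "s \<in> carrier S"
    and fs: "coeff (UP S) f 0 \<otimes>\<^bsub>S\<^esub> s = \<zero>\<^bsub>S\<^esub>" "coeff (UP S) f 1 \<otimes>\<^bsub>S\<^esub> s = \<zero>\<^bsub>S\<^esub>"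
  shows "f \<otimes>\<^bsub>UP S\<^esub> monom (UP S) s 0 = \<zero>\<^bsub>UP S\<^esub>"
proof -
  interpret S: ring S by fact
  interpret UP_ring S "UP S" by unfold_locales auto
  have van: "coeff (UP S) f i \<otimes>\<^bsub>S\<^esub> s = \<zero>\<^bsub>S\<^esub>" for i
  proof (cases "i \<le> 1")
    case True
    then show ?thesis using fs by (auto simp: le_Suc_eq)
  next
    case False
    then show ?thesis using deg_aboveD[of f i] f df s by simp
  qed
  show ?thesis
  proof (rule up_eqI)
    fix n
    have "coeff (UP S) (f \<otimes>\<^bsub>UP S\<^esub> monom (UP S) s 0) n
        = (\<Oplus>\<^bsub>S\<^esub>i\<in>{..n}. coeff (UP S) f i \<otimes>\<^bsub>S\<^esub> (if 0 = n - i then s else \<zero>\<^bsub>S\<^esub>))"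
      using f s by simp
    also have "\<dots> = (\<Oplus>\<^bsub>S\<^esub>i\<in>{..n}. \<zero>\<^bsub>S\<^esub>)"
      using f van by (intro S.finsum_cong') auto
    finally show "coeff (UP S) (f \<otimes>\<^bsub>UP S\<^esub> monom (UP S) s 0) n = coeff (UP S) \<zero>\<^bsub>UP S\<^esub> n"
      by simp
  qed (use f s in auto)
qed

lemma const_mult_linear_zero:
  assumes "ring S" and g: "g \<in> carrier (UP S)" and dg: "deg S g \<le> 1" and s: "s \<in> carrier S"
    and sg: "s \<otimes>\<^bsub>S\<^esub> coeff (UP S) g 0 = \<zero>\<^bsub>S\<^esub>" "s \<otimes>\<^bsub>S\<^esub> coeff (UP S) g 1 = \<zero>\<^bsub>S\<^esub>"
  shows "monom (UP S) s 0 \<otimes>\<^bsub>UP S\<^esub> g = \<zero>\<^bsub>UP S\<^esub>"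
proof -
  interpret S: ring S by fact
  interpret UP_ring S "UP S" by unfold_locales auto
  show ?thesis
  proof (rule up_eqI)
    fix n
    have "s \<otimes>\<^bsub>S\<^esub> coeff (UP S) g n = \<zero>\<^bsub>S\<^esub>"
    proof (cases "n \<le> 1")
      case True
      then show ?thesis using sg by (auto simp: le_Suc_eq)
    next
      case False
      then show ?thesis using deg_aboveD[of g n] g dg s by simp
    qed
    then show "coeff (UP S) (monom (UP S) s 0 \<otimes>\<^bsub>UP S\<^esub> g) n = coeff (UP S) \<zero>\<^bsub>UP S\<^esub> n"
      using g s by (simp add: monom_mult_is_smult del: coeff_mult)
  qed (use g s in auto)
qed

section \<open>Countable rings on the natural numbers\<close>

text \<open>
  This lets a countable ring be studied on a type of its own, with type class algebra, before it
  becomes a ring on natural numbers.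
\<close>

definition nat_copy :: "'a::{ring_1, countable} itself \<Rightarrow> nat ring" where
  "nat_copy T = \<lparr>carrier = range (to_nat :: 'a \<Rightarrow> nat),
     monoid.mult = (\<lambda>m n. to_nat (from_nat m * from_nat n :: 'a)),
     one = to_nat (1 :: 'a), zero = to_nat (0 :: 'a),
     add = (\<lambda>m n. to_nat (from_nat m + from_nat n :: 'a))\<rparr>"

lemma nat_copy_simps [simp]:
  fixes x y :: "'a::{ring_1, countable}"
  shows "carrier (nat_copy TYPE('a)) = range (to_nat :: 'a \<Rightarrow> nat)"
    "to_nat x \<otimes>\<^bsub>nat_copy TYPE('a)\<^esub> to_nat y = to_nat (x * y)"
    "to_nat x \<oplus>\<^bsub>nat_copy TYPE('a)\<^esub> to_nat y = to_nat (x + y)"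
    "\<one>\<^bsub>nat_copy TYPE('a)\<^esub> = to_nat (1 :: 'a)"
    "\<zero>\<^bsub>nat_copy TYPE('a)\<^esub> = to_nat (0 :: 'a)"
  by (simp_all add: nat_copy_def)

lemma ring_nat_copy: "ring (nat_copy TYPE('a::{ring_1, countable}))"
proof (intro ringI abelian_groupI monoidI)
  fix u assume "u \<in> carrier (nat_copy TYPE('a))"
  then obtain x :: 'a where "u = to_nat x" by auto
  then show "\<exists>v\<in>carrier (nat_copy TYPE('a)). v \<oplus>\<^bsub>nat_copy TYPE('a)\<^esub> u = \<zero>\<^bsub>nat_copy TYPE('a)\<^esub>"
    by (auto intro!: exI[of _ "- x"])
qed (auto simp: algebra_simps)

lemma nat_copy_square:
  "to_nat (x :: 'a::{ring_1, countable}) [^]\<^bsub>nat_copy TYPE('a)\<^esub> (2::nat) = to_nat (x * x)"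
proof -
  interpret ring "nat_copy TYPE('a)" by (rule ring_nat_copy)
  show ?thesis by (simp add: numeral_2_eq_2)
qed

text \<open>
  Annihilating a linear polynomial by a constant means annihilating its two coefficients, so both
  McCoy conditions become statements on quadruples of ring elements.
\<close>

lemma nat_copy_linearly_McCoy:
  assumes ex: "\<And>a b c d :: 'a::{ring_1, countable}.
      a * c = 0 \<Longrightarrow> a * d + b * c = 0 \<Longrightarrow> b * d = 0 \<Longrightarrow> a \<noteq> 0 \<or> b \<noteq> 0 \<Longrightarrow> c \<noteq> 0 \<or> d \<noteq> 0 \<Longrightarrow>
      (\<exists>s. s \<noteq> 0 \<and> a * s = 0 \<and> b * s = 0) \<and> (\<exists>s. s \<noteq> 0 \<and> s * c = 0 \<and> s * d = 0)"
  shows "right_linearly_McCoy (nat_copy TYPE('a)) \<and> left_linearly_McCoy (nat_copy TYPE('a))"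
proof -
  let ?S = "nat_copy TYPE('a)"
  interpret ring ?S by (rule ring_nat_copy)
  interpret UP_ring ?S "UP ?S" by unfold_locales auto
  have main: "(\<exists>s\<in>carrier ?S. s \<noteq> \<zero>\<^bsub>?S\<^esub> \<and> f \<otimes>\<^bsub>UP ?S\<^esub> monom (UP ?S) s 0 = \<zero>\<^bsub>UP ?S\<^esub>) \<and>
      (\<exists>s\<in>carrier ?S. s \<noteq> \<zero>\<^bsub>?S\<^esub> \<and> monom (UP ?S) s 0 \<otimes>\<^bsub>UP ?S\<^esub> g = \<zero>\<^bsub>UP ?S\<^esub>)"
    if f: "f \<in> carrier (UP ?S)" "deg ?S f \<le> 1" "f \<noteq> \<zero>\<^bsub>UP ?S\<^esub>"
      and g: "g \<in> carrier (UP ?S)" "deg ?S g \<le> 1" "g \<noteq> \<zero>\<^bsub>UP ?S\<^esub>"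
      and fg: "f \<otimes>\<^bsub>UP ?S\<^esub> g = \<zero>\<^bsub>UP ?S\<^esub>" for f g
  proof -
    obtain a b c d :: 'a where
      coeffs: "coeff (UP ?S) f 0 = to_nat a" "coeff (UP ?S) f 1 = to_nat b"
        "coeff (UP ?S) g 0 = to_nat c" "coeff (UP ?S) g 1 = to_nat d"
      using coeff_closed[OF f(1)] coeff_closed[OF g(1)] by (metis nat_copy_simps(1) rangeE)
    have "a * c = 0" "a * d + b * c = 0" "b * d = 0"
      using coeffs_linear_product[OF ring_nat_copy f(1) g(1) f(2) g(2) fg]
      unfolding coeffs by simp_all
    moreover have "a \<noteq> 0 \<or> b \<noteq> 0" "c \<noteq> 0 \<or> d \<noteq> 0"
      using linear_nonzero_coeff[OF ring_nat_copy f] linear_nonzero_coeff[OF ring_nat_copy g]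
      unfolding coeffs by simp_all
    ultimately obtain s t where "s \<noteq> 0" "a * s = 0" "b * s = 0" "t \<noteq> 0" "t * c = 0" "t * d = 0"
      using ex by blast
    then show ?thesis
      using linear_mult_const_zero[OF ring_nat_copy f(1,2), of "to_nat s"]
        const_mult_linear_zero[OF ring_nat_copy g(1,2), of "to_nat t"]
      unfolding coeffs
      by (intro conjI bexI[of _ "to_nat s"] bexI[of _ "to_nat t"]) auto
  qed
  show ?thesis
    unfolding right_linearly_McCoy_def left_linearly_McCoy_def using main by blast
qed

lemma nat_copy_not_right_Dischinger:
  fixes s y :: "'a::{ring_1, countable}"
  assumes "s = s * s * y" and "\<And>z. s \<noteq> z * (s * s)"
  shows "\<not> right_Dischinger (nat_copy TYPE('a))"
proof
  assume "right_Dischinger (nat_copy TYPE('a))"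
  moreover have "to_nat s = to_nat (s * s) \<otimes>\<^bsub>nat_copy TYPE('a)\<^esub> to_nat y"
    by (simp flip: assms(1))
  then have "right_strongly_regular (nat_copy TYPE('a)) (to_nat s)"
    unfolding right_strongly_regular_def nat_copy_square by (rule bexI) simp
  ultimately have "left_strongly_regular (nat_copy TYPE('a)) (to_nat s)"
    unfolding right_Dischinger_def strongly_regular_def by simp
  then obtain z :: 'a where "to_nat s = to_nat z \<otimes>\<^bsub>nat_copy TYPE('a)\<^esub> to_nat (s * s)"
    unfolding left_strongly_regular_def nat_copy_square by auto
  then have "s = z * (s * s)"
    by simp
  with assms(2) show False ..
qed

abbreviation lookup :: "('a \<Rightarrow>\<^sub>0 'b::zero) \<Rightarrow> 'a \<Rightarrow> 'b" where
  "lookup \<equiv> Poly_Mapping.lookup"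

abbreviation keys :: "('a \<Rightarrow>\<^sub>0 'b::zero) \<Rightarrow> 'a set" where
  "keys \<equiv> Poly_Mapping.keys"

text \<open>
  A finitely supported function is coded by the finite set of its nonzero entries, which makes
  the monoid ring of a countable monoid countable.
\<close>

lemma graph_determines_poly_mapping:
  fixes x y :: "'a \<Rightarrow>\<^sub>0 'b::zero"
  assumes "(\<lambda>k. (k, lookup x k)) ` keys x = (\<lambda>k. (k, lookup y k)) ` keys y"
  shows "x = y"
proof (rule poly_mapping_eqI)
  fix k :: 'a
  have mem: "(k, v) \<in> (\<lambda>k. (k, lookup z k)) ` keys z \<longleftrightarrow> v = lookup z k \<and> v \<noteq> 0"
    for v and z :: "'a \<Rightarrow>\<^sub>0 'b"
    by (auto simp: in_keys_iff)
  show "lookup x k = lookup y k"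
    using mem[of "lookup x k" x] mem[of "lookup x k" y] mem[of "lookup y k" x]
      mem[of "lookup y k" y] assms by (cases "lookup x k = 0") auto
qed

instance poly_mapping :: (countable, "{zero, countable}") countable
  by (rule countable_classI[of "\<lambda>x. to_nat (Abs_fset ((\<lambda>k. (k, lookup x k)) ` keys x))"])
    (simp add: Abs_fset_inject graph_determines_poly_mapping)

section \<open>The monoid with generators \<open>s\<close>, \<open>y\<close> and relation \<open>ssy = s\<close>\<close>

text \<open>
  The words without factor \<open>ssy\<close> are normal forms for the monoid. Such a word consists of
  a product of factors \<open>y\<close> and \<open>q = sy\<close> followed by a power of \<open>s\<close>.
  The term \<open>NF z j\<close> stands for \<open>z s\<^sup>j\<close>, where the list \<open>z\<close> has
  \<^const>\<open>True\<close> for \<open>y\<close> and \<^const>\<open>False\<close> for \<open>q\<close>; the order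
  \<open>False < True\<close> is the one wanted for leading terms.
\<close>

datatype nform = NF "bool list" nat

instance nform :: countable by countable_datatype

text \<open>
  Left multiplication by \<open>s\<close>: the clauses are \<open>s s\<^sup>j = s\<^bsup>j+1\<^esup>\<close>,
  \<open>s y z = q z\<close> and \<open>s q z = ssy z = s z\<close>.
\<close>

function s_times :: "nform \<Rightarrow> nform" where
  "s_times (NF [] j) = NF [] (Suc j)"
| "s_times (NF (True # z) j) = NF (False # z) j"
| "s_times (NF (False # z) j) = s_times (NF z j)"
  by pat_completeness auto
termination
  by (relation "measure (\<lambda>NF z j \<Rightarrow> length z)") auto

fun prepend :: "bool list \<Rightarrow> nform \<Rightarrow> nform" where
  "prepend w (NF z j) = NF (w @ z) j"

lemma prepend_append: "prepend (v @ w) m = prepend v (prepend w m)"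
  by (cases m) simp

lemma prepend_Nil [simp]: "prepend [] m = m"
  by (cases m) simp

lemma s_times_funpow_Nil: "(s_times ^^ i) (NF [] j) = NF [] (i + j)"
  by (induction i) auto

lemma s_times_Cons_False: "s_times (prepend (False # z) m) = s_times (prepend z m)"
  by (cases m) simp

lemma s_times_Cons_True: "s_times (prepend (True # z) m) = prepend (False # z) m"
  by (cases m) simp

text \<open>
  The operation is written additively because \<^typ>\<open>'a \<Rightarrow>\<^sub>0 'b\<close> is the monoid ring of an
  additive monoid; it is not commutative. Associativity reduces to \<open>s (m n) = (s m) n\<close>.
\<close>

instantiation nform :: monoid_add
begin

definition zero_nform :: nform where
  "zero_nform = NF [] 0"

fun plus_nform :: "nform \<Rightarrow> nform \<Rightarrow> nform" where
  "NF z i + m = prepend z ((s_times ^^ i) m)"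

lemma s_times_add: "s_times (m + n) = s_times m + (n :: nform)"
proof (induction m rule: s_times.induct)
  case (2 z j)
  then show ?case by (simp add: s_times_Cons_True)
next
  case (3 z j)
  then show ?case by (simp add: s_times_Cons_False)
qed simp

lemma s_times_funpow_add: "(s_times ^^ i) (m + n) = (s_times ^^ i) m + (n :: nform)"
  by (induction i) (simp_all add: s_times_add)

instance
proof
  fix l m n :: nform
  obtain z i where l: "l = NF z i" by (cases l)
  have "prepend z m' + n = prepend z (m' + n)" for m'
    by (cases m') (simp add: prepend_append)
  then show "l + m + n = l + (m + n)"
    by (simp add: l s_times_funpow_add)
  show "0 + m = m" by (simp add: zero_nform_def)
  show "m + 0 = m" by (cases m) (simp add: zero_nform_def s_times_funpow_Nil)
qed

end

lemma s_times_cases: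
  assumes "s_times (NF z j) = NF t k"
  shows "(t = [] \<and> k = Suc j) \<or> (k = j \<and> (\<exists>r u. z = r @ True # u \<and> t = False # u))"
  using assms
proof (induction "NF z j" arbitrary: z rule: s_times.induct)
  case (2 z)
  then show ?case by (metis append_Nil nform.inject s_times.simps(2))
next
  case (3 z)
  then show ?case by (metis append_Cons s_times.simps(3))
qed auto

text \<open>
  A single \<open>s\<close> already leaves a leading \<open>q\<close> in front of a suffix that had a
  \<open>y\<close> there; the next one erases this \<open>q\<close> and moves on to a later \<open>y\<close>. So
  any positive power of \<open>s\<close> has the same shape of effect, unless the letters \<open>y\<close> run out
  and the exponent grows.
\<close>

lemma s_times_funpow_cases:
  assumes "(s_times ^^ Suc i) (NF z j) = NF t k"
  shows "j < k \<or> (k = j \<and> (\<exists>r u. z = r @ True # u \<and> t = False # u))"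
  using assms
proof (induction i arbitrary: t k)
  case 0
  then show ?case using s_times_cases[of z j t k] by auto
next
  case (Suc i)
  obtain t' k' where step: "(s_times ^^ Suc i) (NF z j) = NF t' k'"
    by (metis nform.exhaust)
  then have last: "s_times (NF t' k') = NF t k"
    using Suc.prems by simp
  show ?case
  proof (cases "j < k \<or> k' \<noteq> j")
    case True
    then show ?thesis using Suc.IH[OF step] s_times_cases[OF last] by auto
  next
    case False
    then obtain r u where z: "z = r @ True # u" and t': "t' = False # u"
      using Suc.IH[OF step] by auto
    from False s_times_cases[OF last] obtain r' u'
      where "t' = r' @ True # u'" and t: "t = False # u'" and "k = j" by auto
    moreover from this t' obtain r'' where "u = r'' @ True # u'"
      by (cases r') auto
    ultimately show ?thesis using z by (intro disjI2 conjI exI[of _ "r @ True # r''"] exI[of _ u']) auto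
  qed
qed

text \<open>
  Lists are ordered lexicographically, so comparing reversed lists is comparing words from their
  right ends. The next two facts are the two ways in which one word can exceed another.
\<close>

lemma rev_suffix_less:
  "r \<noteq> [] \<Longrightarrow> rev v < rev (r @ (v :: bool list))"
proof -
  have "b \<noteq> [] \<Longrightarrow> a < a @ b" for a b :: "bool list"
    by (induction a) (auto simp: neq_Nil_conv)
  then show "r \<noteq> [] \<Longrightarrow> rev v < rev (r @ v)" by simp
qed

lemma rev_less_at_letter: "rev (r @ False # u) < rev (r' @ True # (u :: bool list))"
proof -
  have "a @ False # b < a @ True # c" for a b c :: "bool list"
    by (induction a) auto
  then show ?thesis by simp
qed

text \<open>
  Here \<open>w\<close> plays the role of a longest word among those terms of the left factor that do not
  end in \<open>s\<close>, and \<open>v s\<^sup>j\<close> the leading term of the right factor. If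
  \<open>i = 0\<close>, the product is a concatenation, and a first word shorter than \<open>w\<close> would
  require a second word having \<open>v\<close> as proper suffix, which is too large. If \<open>i > 0\<close>,
  then \<open>z' = r y u\<close> and the product is \<open>z q u\<close> followed by the power of
  \<open>s\<close>. Its suffix \<open>v\<close> either lies inside \<open>u\<close> or contains \<open>q u\<close>;
  in both cases \<open>z'\<close> is larger than \<open>v\<close>.
\<close>

lemma leading_factorization_unique:
  assumes eq: "NF z i + NF z' j' = NF w 0 + NF v j"
    and long: "i = 0 \<Longrightarrow> length z \<le> length w"
    and least: "j \<le> j'" and greatest: "j' = j \<Longrightarrow> rev z' \<le> rev v"
  shows "NF z i = NF w 0 \<and> NF z' j' = NF v j"
proof (cases i)
  case 0
  with eq have zz: "z @ z' = w @ v" and j: "j' = j" by auto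
  \<comment> \<open>by \<open>long\<close>, it is \<open>z\<close> that is a prefix of \<open>w\<close>\<close>
  then obtain r where w: "w = z @ r" and z': "z' = r @ v"
    using long[OF 0] by (auto simp: append_eq_append_conv2)
  have "r = []"
    using rev_suffix_less[of r v] greatest[OF j] z' by (meson leD)
  then show ?thesis using w z' j 0 by simp
next
  case (Suc i')
  obtain t k where tk: "(s_times ^^ Suc i') (NF z' j') = NF t k" by (metis nform.exhaust)
  with eq Suc have wv: "z @ t = w @ v" and "k = j" by auto
  with s_times_funpow_cases[OF tk] least obtain r u
    where j: "j' = j" and z': "z' = r @ True # u" and t: "t = False # u" by auto
  \<comment> \<open>the suffix \<open>v\<close> of \<open>z q u\<close> either contains the letter \<open>q\<close> in front of \<open>u\<close> or not\<close>
  from wv t obtain e where "v = e @ False # u \<or> e @ v = u"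
    by (fastforce simp: append_eq_append_conv2 Cons_eq_append_conv)
  then have "rev v < rev z'"
    using rev_less_at_letter[of e u r] rev_suffix_less[of "r @ True # e" v] z' by auto
  then show ?thesis
    using greatest[OF j] by simp
qed

section \<open>The monoid ring\<close>

text \<open>
  A product that arises from one pair of support elements only cannot be cancelled.
\<close>

lemma lookup_mult_unique:
  fixes x y :: "'a::monoid_add \<Rightarrow>\<^sub>0 'b::semiring_0" and m n :: 'a
  assumes "\<And>k l. k \<in> keys x \<Longrightarrow> l \<in> keys y \<Longrightarrow> k + l = m + n \<Longrightarrow> k = m \<and> l = n"
  shows "lookup (x * y) (m + n) = lookup x m * lookup y n"
proof -
  have "lookup (x * y) (m + n) = (\<Sum>(a, b). (lookup x a * lookup y b when m + n = a + b))"
    by (simp add: times_poly_mapping.rep_eq prod_fun_unfold_prod)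
  also have "\<dots> = (\<Sum>p. (lookup x m * lookup y n when p = (m, n)))"
  proof (intro arg_cong[where f = Sum_any] ext)
    fix p :: "'a \<times> 'a"
    obtain k l where p: "p = (k, l)" by (cases p)
    have "lookup x k * lookup y l = 0" if "m + n = k + l" "p \<noteq> (m, n)"
    proof -
      have "k \<notin> keys x \<or> l \<notin> keys y" using assms[of k l] that p by auto
      then show ?thesis by (auto simp: in_keys_iff)
    qed
    then show "(case p of (a, b) \<Rightarrow> lookup x a * lookup y b when m + n = a + b)
        = (lookup x m * lookup y n when p = (m, n))"
      by (auto simp: p when_def)
  qed
  finally show ?thesis by simp
qed

lemma finite_nonempty_maximizer:
  fixes f :: "'a \<Rightarrow> 'b::linorder"
  assumes "finite A" "A \<noteq> {}"
  shows "\<exists>a\<in>A. \<forall>x\<in>A. f x \<le> f a"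
proof -
  have "Max (f ` A) \<in> f ` A" using assms by (intro Max_in) auto
  then obtain a where "a \<in> A" "Max (f ` A) = f a" by auto
  with assms show ?thesis by (metis Max_ge finite_imageI imageI)
qed

lemma finite_keys_with_exponent:
  fixes x :: "nform \<Rightarrow>\<^sub>0 'b::zero"
  shows "finite {z. NF z j \<in> keys x}"
proof (rule finite_imageD)
  show "finite ((\<lambda>z. NF z j) ` {z. NF z j \<in> keys x})"
    by (rule finite_subset[OF _ finite_keys[of x]]) auto
qed (auto intro: inj_onI)

lemma maximal_word:
  fixes x :: "nform \<Rightarrow>\<^sub>0 'b::zero" and f :: "bool list \<Rightarrow> 'c::linorder"
  assumes "NF z j \<in> keys x"
  obtains w where "NF w j \<in> keys x" "\<And>z. NF z j \<in> keys x \<Longrightarrow> f z \<le> f w"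
proof -
  have "{z. NF z j \<in> keys x} \<noteq> {}" using assms by auto
  from finite_nonempty_maximizer[OF finite_keys_with_exponent this, of f]
  show ?thesis using that by auto
qed

lemma least_exponent:
  fixes x :: "nform \<Rightarrow>\<^sub>0 'b::zero"
  assumes "x \<noteq> 0"
  obtains w n where "NF w n \<in> keys x" "\<And>z i. NF z i \<in> keys x \<Longrightarrow> n \<le> i"
proof -
  have "\<exists>m. m \<in> keys x"
    using assms by (auto simp: in_keys_iff intro: poly_mapping_eqI)
  then obtain z1 i1 where zi1: "NF z1 i1 \<in> keys x"
    by (metis nform.exhaust)
  define n where "n = (LEAST i. \<exists>z. NF z i \<in> keys x)"
  have "\<exists>w. NF w n \<in> keys x"
    unfolding n_def by (rule LeastI[of _ i1]) (use zi1 in auto)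
  moreover have "n \<le> i" if "NF z i \<in> keys x" for z i
    unfolding n_def by (rule Least_le) (use that in auto)
  ultimately show ?thesis using that by blast
qed

text \<open>
  The leading term of \<open>c\<close> is chosen with the least exponent \<open>j\<close> of \<open>s\<close>
  first, because left multiplication never lowers that exponent; among those it is the largest
  when words are read from the right. The partner in \<open>x\<close> has to be a longest word that does not
  end in \<open>s\<close>, whatever the length of the words in \<open>x\<close> that do.
\<close>

lemma mult_nonzero_if_key_without_s:
  fixes x c :: "nform \<Rightarrow>\<^sub>0 'b::semiring_no_zero_divisors"
  assumes x: "NF w0 0 \<in> keys x" and "c \<noteq> 0"
  shows "x * c \<noteq> 0"
proof -
  obtain w where w: "NF w 0 \<in> keys x" and
    wmax: "\<And>z. NF z 0 \<in> keys x \<Longrightarrow> length z \<le> length w"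
    using maximal_word[OF x, of length] by blast
  obtain v0 j where v0: "NF v0 j \<in> keys c" and
    jmin: "\<And>z j'. NF z j' \<in> keys c \<Longrightarrow> j \<le> j'"
    using least_exponent[OF \<open>c \<noteq> 0\<close>] by blast
  obtain v where v: "NF v j \<in> keys c" and
    vmax: "\<And>z. NF z j \<in> keys c \<Longrightarrow> rev z \<le> rev v"
    using maximal_word[OF v0, of rev] by blast
  have "lookup (x * c) (NF w 0 + NF v j) = lookup x (NF w 0) * lookup c (NF v j)"
  proof (rule lookup_mult_unique)
    fix k l assume kl: "k \<in> keys x" "l \<in> keys c" "k + l = NF w 0 + NF v j"
    obtain z i z' j' where k: "k = NF z i" and l: "l = NF z' j'" by (metis nform.exhaust)
    show "k = NF w 0 \<and> l = NF v j"
      using kl wmax vmax jmin unfolding k l by (intro leading_factorization_unique) auto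
  qed
  also have "\<dots> \<noteq> 0"
    using w v by (simp add: in_keys_iff)
  finally show ?thesis by auto
qed

abbreviation monomial :: "nform \<Rightarrow> nform \<Rightarrow>\<^sub>0 int" where
  "monomial m \<equiv> Poly_Mapping.single m 1"

definition s_elt :: "nform \<Rightarrow>\<^sub>0 int" where
  "s_elt = monomial (NF [] 1)"

definition y_elt :: "nform \<Rightarrow>\<^sub>0 int" where
  "y_elt = monomial (NF [True] 0)"

lemma s_elt_power: "s_elt ^ n = monomial (NF [] n)"
proof (induction n)
  case 0
  show ?case by (simp add: zero_nform_def[symmetric])
next
  case (Suc n)
  then show ?case by (simp add: s_elt_def mult_single)
qed

lemma s_elt_mult_y_elt: "s_elt * y_elt = monomial (NF [False] 0)"
  by (simp add: s_elt_def y_elt_def mult_single)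

lemma s_elt_square_mult_y_elt: "s_elt * s_elt * y_elt = s_elt"
  by (simp add: s_elt_def y_elt_def mult_single)

text \<open>
  The words in the support of a multiple \<open>z s\<^sup>2\<close> have exponent at least \<open>2\<close>.
\<close>

lemma s_elt_not_left_multiple: "s_elt \<noteq> z * (s_elt * s_elt)"
proof
  assume "s_elt = z * (s_elt * s_elt)"
  then have "NF [] 1 \<in> keys (z * monomial (NF [] 2))"
    using s_elt_power[of 2] by (metis power2_eq_square s_elt_def keys_single insertI1 zero_neq_one)
  then obtain m where "NF [] 1 = m + NF [] 2"
    using keys_mult[of z "monomial (NF [] 2)"] by auto
  then show False
    by (cases m) (auto simp: s_times_funpow_Nil)
qed

text \<open>
  Right multiplication by \<open>s\<^sup>n\<close> shifts all exponents by \<open>n\<close>. Hence an element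
  whose exponents are at least \<open>n\<close> is divisible by \<open>s\<^sup>n\<close>, and for \<open>n\<close>
  the least exponent the quotient contains a word not ending in \<open>s\<close>.
\<close>

lemma factor_out_s:
  assumes "x \<noteq> 0"
  obtains n w x' where "x = x' * s_elt ^ n" "NF w 0 \<in> keys x'"
proof -
  obtain w n where w: "NF w n \<in> keys x" and
    nmin: "\<And>z i. NF z i \<in> keys x \<Longrightarrow> n \<le> i"
    using least_exponent[OF \<open>x \<noteq> 0\<close>] by blast
  have shift: "NF z i + NF [] n = NF z (i + n)" for z i
    by (simp add: s_times_funpow_Nil)
  have inj: "inj (\<lambda>m. m + NF [] n)"
  proof (rule injI)
    fix k m assume "k + NF [] n = m + NF [] n"
    then show "k = m" by (cases k; cases m) (simp only: shift, simp)
  qed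
  define x' where "x' = Poly_Mapping.map_key (\<lambda>m. m + NF [] n) x"
  have look: "lookup x' m = lookup x (m + NF [] n)" for m
    using inj by (simp add: x'_def map_key.rep_eq)
  have "lookup (x' * s_elt ^ n) k = lookup x k" for k
  proof (cases "\<exists>m. k = m + NF [] n")
    case True
    then obtain m where k: "k = m + NF [] n" ..
    have "lookup (x' * monomial (NF [] n)) (m + NF [] n) = lookup x' m * lookup (monomial (NF [] n)) (NF [] n)"
      by (rule lookup_mult_unique) (use inj in \<open>auto dest: injD\<close>)
    then show ?thesis by (simp add: s_elt_power look k)
  next
    case False
    then have "k \<notin> keys x"
      using nmin shift by (metis le_add_diff_inverse2 nform.exhaust)
    moreover have "k \<notin> keys (x' * monomial (NF [] n))"
      using False keys_mult[of x' "monomial (NF [] n)"] by auto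
    ultimately show ?thesis by (simp add: s_elt_power in_keys_iff)
  qed
  then have "x = x' * s_elt ^ n"
    by (metis poly_mapping_eqI)
  moreover have "NF w 0 \<in> keys x'"
    using w shift[of w 0] by (simp add: in_keys_iff look)
  ultimately show ?thesis using that by blast
qed

definition p_elt :: "nform \<Rightarrow>\<^sub>0 int" where
  "p_elt = 1 - s_elt * y_elt"

lemma p_elt_nonzero: "p_elt \<noteq> 0"
proof
  assume "p_elt = 0"
  then have "lookup (1 :: nform \<Rightarrow>\<^sub>0 int) 0 = lookup (monomial (NF [False] 0)) 0"
    by (simp add: p_elt_def s_elt_mult_y_elt)
  then show False by (simp add: lookup_single lookup_one zero_nform_def)
qed

lemma s_elt_power_mult_p_elt:
  assumes "0 < n"
  shows "s_elt ^ n * p_elt = 0"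
proof -
  have "s_elt * p_elt = 0"
    by (simp add: p_elt_def right_diff_distrib s_elt_square_mult_y_elt flip: mult.assoc)
  moreover obtain k where "n = Suc k"
    using assms gr0_conv_Suc by blast
  ultimately show ?thesis
    by (simp add: power_Suc2 mult.assoc del: power_Suc)
qed

text \<open>
  In general \<open>sc = 0\<close> does not follow from \<open>xc = 0\<close>: for example
  \<open>s\<^sup>2 (yp) = 0\<close>, while \<open>s (yp)\<close> is not zero. This is why a power of
  \<open>s\<close> appears.
\<close>

lemma zero_product:
  assumes "x * c = 0" "x \<noteq> 0" "c \<noteq> 0"
  shows "x * p_elt = 0" "\<exists>n. s_elt ^ n * c = 0"
proof -
  obtain n w x' where x: "x = x' * s_elt ^ n" and w: "NF w 0 \<in> keys x'"
    using factor_out_s[OF \<open>x \<noteq> 0\<close>] .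
  have "x' * (s_elt ^ n * c) = 0"
    using \<open>x * c = 0\<close> by (simp add: x mult.assoc)
  then have sc: "s_elt ^ n * c = 0"
    using mult_nonzero_if_key_without_s[OF w] by blast
  then show "\<exists>n. s_elt ^ n * c = 0" ..
  have "0 < n"
    using sc \<open>c \<noteq> 0\<close> by (cases n) auto
  then show "x * p_elt = 0"
    by (simp add: x mult.assoc s_elt_power_mult_p_elt)
qed

lemma s_elt_power_mult_zero_le:
  assumes "s_elt ^ m * c = 0" "m \<le> n"
  shows "s_elt ^ n * c = 0"
proof -
  have "s_elt ^ n = s_elt ^ (n - m) * s_elt ^ m"
    using \<open>m \<le> n\<close> by (simp flip: power_add)
  then show ?thesis using assms(1) by (simp add: mult.assoc)
qed

lemma linear_zero_divisors_annihilated: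
  fixes a b c d :: "nform \<Rightarrow>\<^sub>0 int"
  assumes ac: "a * c = 0" and mixed: "a * d + b * c = 0" and bd: "b * d = 0"
    and f: "a \<noteq> 0 \<or> b \<noteq> 0" and g: "c \<noteq> 0 \<or> d \<noteq> 0"
  shows "(\<exists>s. s \<noteq> 0 \<and> a * s = 0 \<and> b * s = 0) \<and> (\<exists>s. s \<noteq> 0 \<and> s * c = 0 \<and> s * d = 0)"
proof -
  \<comment> \<open>if one coefficient vanishes, the middle coefficient of the product has just one term\<close>
  have zero: "a = 0 \<or> c = 0 \<Longrightarrow> a * d = 0 \<and> b * c = 0" "b = 0 \<or> d = 0 \<Longrightarrow> a * d = 0 \<and> b * c = 0"
    using mixed by auto
  have "a * p_elt = 0"
    using zero_product(1)[of a c] zero_product(1)[of a d] ac zero(1) g by (cases "a = 0") auto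
  moreover have "b * p_elt = 0"
    using zero_product(1)[of b d] zero_product(1)[of b c] bd zero(2) g by (cases "b = 0") auto
  ultimately have right: "\<exists>s. s \<noteq> 0 \<and> a * s = 0 \<and> b * s = 0"
    using p_elt_nonzero by blast
  have "\<exists>m. s_elt ^ m * c = 0"
    using zero_product(2)[of a c] zero_product(2)[of b c] ac zero(1) f by (cases "c = 0") auto
  moreover have "\<exists>n. s_elt ^ n * d = 0"
    using zero_product(2)[of b d] zero_product(2)[of a d] bd zero(2) f by (cases "d = 0") auto
  ultimately obtain m n where "s_elt ^ m * c = 0" "s_elt ^ n * d = 0"
    by blast
  then have "s_elt ^ max m n * c = 0" "s_elt ^ max m n * d = 0"
    using s_elt_power_mult_zero_le by auto
  moreover have "s_elt ^ max m n \<noteq> 0"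
    unfolding s_elt_power by (metis lookup_single_eq lookup_zero zero_neq_one)
  ultimately show ?thesis
    using right by blast
qed

theorem corollary3p17:
  "\<exists>S :: nat ring.
     ring S \<and> left_linearly_McCoy S \<and> right_linearly_McCoy S \<and> \<not> right_Dischinger S"
proof (intro exI conjI)
  let ?S = "nat_copy TYPE(nform \<Rightarrow>\<^sub>0 int)"
  show "ring ?S" by (rule ring_nat_copy)
  have "right_linearly_McCoy ?S \<and> left_linearly_McCoy ?S"
    by (rule nat_copy_linearly_McCoy) (rule linear_zero_divisors_annihilated)
  then show "left_linearly_McCoy ?S" "right_linearly_McCoy ?S"
    by blast+
  show "\<not> right_Dischinger ?S"
    by (rule nat_copy_not_right_Dischinger[OF s_elt_square_mult_y_elt[symmetric] s_elt_not_left_multiple])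
qed

end
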